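(* Let $k$ be a field of characteristic $2$. Let $\sigma$ be the continuous $k$-algebra endomorphism of the formal power series ring $k[[t]]$ determined by $$\sigma(t) = t + t^2 + \sum_{j=0}^{\infty} \sum_{\ell=0}^{2^j-1} t^{6\cdot 2^j + 2\ell},$$ that is, $$\sigma(t) = t + t^2 + (t^6) + (t^{12}+t^{14}) + (t^{24}+t^{26}+t^{28}+t^{30}) + (t^{48}+\cdots+t^{62}) + \cdots .$$ Then $\sigma$ is an automorphism of $k[[t]]$ of order (exactly) $4$.
   Context: The ring $k[[t]]$ carries the $t$-adic topology. For a power series $f \in t\,k[[t]]$ there is a unique continuous $k$-algebra endomorphism of $k[[t]]$ sending $t$ to $f$, namely the substitution $g(t) \mapsto g(f(t))$. The order of an automorphism is its order as an element of the group of continuous $k$-algebra automorphisms of $k[[t]]$ under composition. *)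

theory Defs
  imports "HOL-Computational_Algebra.Formal_Power_Series" "HOL-Algebra.Multiplicative_Group"
begin

(* The topology on 'k fps is the library's, given by the metric
   dist f g = 2 ^ (- subdegree (f - g)), i.e. the t-adic topology; fps_X plays the role of t. *)
definition cont_alg_endo :: "('k::field fps \<Rightarrow> 'k fps) \<Rightarrow> bool" where
  "cont_alg_endo \<sigma> \<longleftrightarrow>
     \<sigma> 1 = 1 \<and>
     (\<forall>f g. \<sigma> (f + g) = \<sigma> f + \<sigma> g) \<and>
     (\<forall>f g. \<sigma> (f * g) = \<sigma> f * \<sigma> g) \<and>
     (\<forall>c f. \<sigma> (fps_const c * f) = fps_const c * \<sigma> f) \<and>
     continuous_on UNIV \<sigma>"

definition fps_aut_group :: "('k::field fps \<Rightarrow> 'k fps) monoid" where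
  "fps_aut_group =
     \<lparr>carrier = {\<sigma>. cont_alg_endo \<sigma> \<and> (\<exists>\<tau>. cont_alg_endo \<tau> \<and> \<sigma> \<circ> \<tau> = id \<and> \<tau> \<circ> \<sigma> = id)},
      mult = (\<circ>), one = id\<rparr>"

lemma cont_alg_endo_id: "cont_alg_endo id"
  by (simp add: cont_alg_endo_def)

lemma cont_alg_endo_comp:
  assumes "cont_alg_endo \<sigma>" and "cont_alg_endo \<tau>"
  shows "cont_alg_endo (\<sigma> \<circ> \<tau>)"
  using assms unfolding cont_alg_endo_def
  by (auto intro: continuous_on_compose2[of UNIV \<sigma> UNIV \<tau>])

lemma group_fps_aut_group: "group (fps_aut_group :: ('k::field fps \<Rightarrow> 'k fps) monoid)"
proof (rule groupI)
  fix x y :: "'k fps \<Rightarrow> 'k fps"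
  assume "x \<in> carrier fps_aut_group" "y \<in> carrier fps_aut_group"
  then obtain x' y' where x: "cont_alg_endo x" "cont_alg_endo x'" "x \<circ> x' = id" "x' \<circ> x = id"
    and y: "cont_alg_endo y" "cont_alg_endo y'" "y \<circ> y' = id" "y' \<circ> y = id"
    by (auto simp: fps_aut_group_def)
  have "(x \<circ> y) \<circ> (y' \<circ> x') = id" "(y' \<circ> x') \<circ> (x \<circ> y) = id"
    using x y by (auto simp: fun_eq_iff)
  moreover have "cont_alg_endo (x \<circ> y)" "cont_alg_endo (y' \<circ> x')"
    using x y by (auto intro: cont_alg_endo_comp)
  ultimately show "x \<otimes>\<^bsub>fps_aut_group\<^esub> y \<in> carrier fps_aut_group"
    by (auto simp: fps_aut_group_def simp del: o_apply)
next
  fix x :: "'k fps \<Rightarrow> 'k fps"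
  assume "x \<in> carrier fps_aut_group"
  then show "\<exists>y\<in>carrier fps_aut_group. y \<otimes>\<^bsub>fps_aut_group\<^esub> x = \<one>\<^bsub>fps_aut_group\<^esub>"
    by (auto simp: fps_aut_group_def)
qed (auto simp: fps_aut_group_def cont_alg_endo_id o_assoc intro: exI[of _ id])

context
  includes fps_syntax
begin

lemma cont_alg_endo_compose:
  fixes f :: "'k::field fps"
  assumes "f $ 0 = 0"
  shows "cont_alg_endo (\<lambda>g. g oo f)"
proof -
  have "((\<lambda>g. g oo f) \<longlongrightarrow> h oo f) (at h)" for h
  proof (rule tendsto_fpsI)
    fix n
    have "((\<lambda>g. g) \<longlongrightarrow> h) (at h)"
      by (rule tendsto_ident_at)
    then have "\<forall>i\<in>{0..n}. \<forall>\<^sub>F g in at h. g $ i = h $ i"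
      by (auto simp: tendsto_fps_iff)
    then have "\<forall>\<^sub>F g in at h. \<forall>i\<in>{0..n}. g $ i = h $ i"
      by (simp add: eventually_ball_finite_distrib)
    then show "\<forall>\<^sub>F g in at h. (g oo f) $ n = (h oo f) $ n"
      by eventually_elim (simp add: fps_compose_nth)
  qed
  then have "continuous_on UNIV (\<lambda>g. g oo f)"
    by (simp add: continuous_on_def)
  then show ?thesis
    using assms
    by (simp add: cont_alg_endo_def fps_compose_add_distrib fps_compose_mult_distrib)
qed

lemma cont_alg_endo_eq_compose_iff:
  fixes f :: "'k::field fps"
  assumes f: "f $ 0 = 0"
  shows "cont_alg_endo \<sigma> \<and> \<sigma> fps_X = f \<longleftrightarrow> \<sigma> = (\<lambda>g. g oo f)"
proof
  assume "\<sigma> = (\<lambda>g. g oo f)"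
  then show "cont_alg_endo \<sigma> \<and> \<sigma> fps_X = f"
    using f by (simp add: cont_alg_endo_compose)
next
  assume \<sigma>: "cont_alg_endo \<sigma> \<and> \<sigma> fps_X = f"
  let ?p = "\<lambda>g n. \<Sum>i\<in>{0..n}. fps_const (g $ i) * fps_X ^ i"
  have poly: "\<tau> (?p g n) = (\<Sum>i\<in>{0..n}. fps_const (g $ i) * \<tau> fps_X ^ i)"
    if \<tau>: "cont_alg_endo \<tau>" for \<tau> :: "'k fps \<Rightarrow> 'k fps" and g n
  proof -
    have pow: "\<tau> (h ^ i) = \<tau> h ^ i" for h i
      using \<tau> by (induction i) (auto simp: cont_alg_endo_def)
    show ?thesis
      using \<tau> by (induction n) (auto simp: cont_alg_endo_def pow simp del: power_Suc)
  qed
  have lim: "(\<lambda>n. \<tau> (?p g n)) \<longlonglongrightarrow> \<tau> g"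
    if "cont_alg_endo \<tau>" for \<tau> :: "'k fps \<Rightarrow> 'k fps" and g
    using that continuous_on_tendsto_compose[OF _ fps_notation, of UNIV \<tau> g]
    by (simp add: cont_alg_endo_def)
  show "\<sigma> = (\<lambda>g. g oo f)"
  proof
    fix g
    have "(\<lambda>n. \<sigma> (?p g n)) \<longlonglongrightarrow> (g oo f)"
      using lim[OF cont_alg_endo_compose[OF f], of g] poly[OF cont_alg_endo_compose[OF f], of g]
        poly[of \<sigma> g] \<sigma> f by simp
    then show "\<sigma> g = g oo f"
      using lim[of \<sigma> g] \<sigma> LIMSEQ_unique by blast
  qed
qed

lemma summable_t_series:
  "summable (\<lambda>j. \<Sum>l<2^j. fps_X ^ (6 * 2^j + 2 * l) :: 'k::field fps)"
proof -
  define a :: "nat \<Rightarrow> 'k fps" where "a = (\<lambda>j. \<Sum>l<2^j. fps_X ^ (6 * 2^j + 2 * l))"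
  have a0: "a j $ n = 0" if "n < j" for j n
  proof -
    have "n < 2 ^ j"
      using that less_exp[of j] by linarith
    then show ?thesis
      by (auto simp: a_def fps_sum_nth intro!: sum.neutral)
  qed
  have "(\<lambda>m. \<Sum>j<m. a j) \<longlonglongrightarrow> Abs_fps (\<lambda>n. \<Sum>j\<le>n. a j $ n)"
  proof (rule tendsto_fpsI)
    fix n
    show "\<forall>\<^sub>F m in sequentially.
        (\<Sum>j<m. a j) $ n = Abs_fps (\<lambda>n. \<Sum>j\<le>n. a j $ n) $ n"
      using eventually_gt_at_top[of n]
    proof eventually_elim
      case (elim m)
      have "(\<Sum>j<m. a j $ n) = (\<Sum>j\<le>n. a j $ n)"
        using elim by (intro sum.mono_neutral_right) (auto intro: a0)
      then show ?case
        by (simp add: fps_sum_nth)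
    qed
  qed
  then show ?thesis
    unfolding a_def summable_def sums_def by blast
qed

end

end

theory Submission
  imports Defs
begin

text \<open>
  Write \<open>S\<close> for the double series and \<open>F = \<sigma>(t)\<close>. The blocks \<open>a\<^sub>j\<close> of \<open>S\<close> satisfy
  \<open>a\<^sub>j\<^sub>+\<^sub>1 = (1 + t\<^sup>2) a\<^sub>j\<^sup>2\<close>, so \<open>S = t\<^sup>6 + (1 + t\<^sup>2) S\<^sup>2\<close> and hence \<open>F + (1 + t\<^sup>2) F\<^sup>2 = t\<close>.
  With \<open>y = (1 + t\<^sup>2) F\<close> this is the supersingular elliptic curve \<open>y\<^sup>2 + y = t\<^sup>3 + t\<close>, of which
  \<open>\<sigma>\<close> is an automorphism of order 4 fixing the point \<open>(0, 0)\<close>; explicitly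
  \<open>\<sigma>(y) = F + (1 + t) F\<^sup>2\<close>. It follows that \<open>t\<close> and \<open>G = \<sigma>\<^sup>2(t)\<close> satisfy the relation
  \<open>t + G + t\<^sup>2 + G\<^sup>2 + t\<^sup>2 G\<^sup>2 = 0\<close>, which is symmetric. As a quadratic equation over \<open>k[[t]]\<close> for one
  of the two series it has only one root without constant term, so \<open>\<sigma>\<^sup>4(t) = t\<close>; and \<open>G = t\<close>
  would give \<open>t\<^sup>4 = 0\<close>.
\<close>

lemma two_eq_0_char_2: "CHAR('a) = 2 \<Longrightarrow> 2 = (0 :: 'a :: comm_ring_1)"
  by (metis of_nat_CHAR of_nat_numeral)

lemma add_self_char_2: "CHAR('a) = 2 \<Longrightarrow> a + a = (0 :: 'a :: comm_ring_1)"
  by (metis mult_2 mult_zero_left two_eq_0_char_2)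

lemma add_left_self_char_2: "CHAR('a) = 2 \<Longrightarrow> a + (a + b) = (b :: 'a :: comm_ring_1)"
  by (simp add: add_self_char_2 flip: add.assoc)

lemma add_eq_0_iff_char_2: "CHAR('a) = 2 \<Longrightarrow> a + b = 0 \<longleftrightarrow> a = (b :: 'a :: comm_ring_1)"
  by (metis add_left_self_char_2 add_self_char_2 add.right_neutral)

lemma power2_add_char_2: "CHAR('a) = 2 \<Longrightarrow> (a + b)\<^sup>2 = a\<^sup>2 + (b :: 'a :: comm_ring_1)\<^sup>2"
  using add_self_char_2[of "a * b"] by (simp add: power2_eq_square algebra_simps)

lemmas char_2_simps =
  two_eq_0_char_2 add_self_char_2 add_left_self_char_2 power2_add_char_2 algebra_simps

text \<open>In characteristic 2 the map sending \<open>z\<close> to \<open>c * z^2 + z\<close> is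
  additive, so \<open>p + q\<close> is a root of \<open>z * (c * z + 1)\<close>. For power series
  \<open>p\<close>, \<open>q\<close> without constant term the second factor cannot vanish.\<close>

lemma artin_schreier_char_2_eq:
  fixes p q :: "'a :: idom"
  assumes "CHAR('a) = 2" and "c * p\<^sup>2 + p = c * q\<^sup>2 + q" and "c * (p + q) \<noteq> 1"
  shows "p = q"
proof -
  note [simp] = add_eq_0_iff_char_2[OF assms(1)]
  have "(p + q) * (c * (p + q) + 1) = (c * p\<^sup>2 + p) + (c * q\<^sup>2 + q)"
    using assms(1) by (simp add: char_2_simps power2_eq_square)
  also have "\<dots> = 0"
    using assms(2) by (simp only: add_self_char_2[OF assms(1)])
  finally show "p = q"
    using assms(3) by simp
qed

lemma curve_map_relation:
  fixes x f g :: "'a :: idom"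
  assumes "CHAR('a) = 2"
    and f: "f + (1 + x\<^sup>2) * f\<^sup>2 = x"
    and g: "g * (1 + f\<^sup>2) = f + (1 + x) * f\<^sup>2"
    and nz: "1 + f\<^sup>2 \<noteq> 0"
  shows "x + g + x\<^sup>2 + g\<^sup>2 + x\<^sup>2 * g\<^sup>2 = 0"
proof -
  define d n r where "d = 1 + f\<^sup>2" and "n = f + (1 + x) * f\<^sup>2" and "r = f + (1 + x\<^sup>2) * f\<^sup>2 + x"
  have "d\<^sup>2 * (x + g + x\<^sup>2 + g\<^sup>2 + x\<^sup>2 * g\<^sup>2) = d * (g * d) + (g * d)\<^sup>2 * (1 + x\<^sup>2) + (x + x\<^sup>2) * d\<^sup>2"
    by (simp add: algebra_simps power2_eq_square)
  also have "g * d = n"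
    using g by (simp add: d_def n_def)
  \<comment> \<open>Clearing the denominator of \<open>g = n / d\<close> leaves a polynomial in
    \<open>x\<close> and \<open>f\<close>. It is divisible by the equation \<open>r\<close> of the
    curve, with cofactor \<open>1 + r + f^2\<close>.\<close>
  also have "d * n + n\<^sup>2 * (1 + x\<^sup>2) + (x + x\<^sup>2) * d\<^sup>2 = r * (1 + r + f\<^sup>2)"
    using assms(1) unfolding d_def n_def r_def by (simp add: char_2_simps power2_eq_square)
  also have "r = 0"
    unfolding r_def f by (rule add_self_char_2[OF assms(1)])
  finally show ?thesis
    using nz by (simp add: d_def)
qed

text \<open>Squaring acts termwise and spreads the exponents to steps of 4; the factor
  \<open>1 + x^2\<close> fills the gaps. This links consecutive blocks of the series.\<close>

lemma square_geometric_sum_char_2: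
  fixes x :: "'a :: comm_ring_1"
  assumes "CHAR('a) = 2"
  shows "(1 + x\<^sup>2) * (\<Sum>l<m. x ^ (a + 2 * l))\<^sup>2 = (\<Sum>l<2 * m. x ^ (2 * a + 2 * l))"
proof (induction m)
  case (Suc m)
  have "(1 + x\<^sup>2) * (\<Sum>l<Suc m. x ^ (a + 2 * l))\<^sup>2
      = (\<Sum>l<2 * m. x ^ (2 * a + 2 * l)) + (1 + x\<^sup>2) * (x ^ (a + 2 * m))\<^sup>2"
    by (simp add: power2_add_char_2[OF assms] distrib_left flip: Suc.IH)
  also have "(1 + x\<^sup>2) * (x ^ (a + 2 * m))\<^sup>2
      = x ^ (2 * a + 2 * (2 * m)) + x ^ (2 * a + 2 * Suc (2 * m))"
    by (simp add: algebra_simps flip: power_mult power_add)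
  finally show ?case
    by (simp add: add.assoc)
qed simp

text \<open>Coefficient \<open>n\<close> of a product involves only coefficients up to
  \<open>n\<close> of the factors, and these finitely many eventually agree with those of the
  limits.\<close>

lemma tendsto_mult_fps:
  fixes f g :: "'b \<Rightarrow> 'a :: comm_ring_1 fps"
  assumes "(f \<longlongrightarrow> a) F" and "(g \<longlongrightarrow> b) F"
  shows "((\<lambda>x. f x * g x) \<longlongrightarrow> a * b) F"
proof (rule tendsto_fpsI)
  fix n
  have "\<forall>\<^sub>F x in F. \<forall>i\<in>{0..n}. fps_nth (f x) i = fps_nth a i"
    using assms(1) by (auto simp: eventually_ball_finite_distrib tendsto_fps_iff)
  moreover have "\<forall>\<^sub>F x in F. \<forall>i\<in>{0..n}. fps_nth (g x) i = fps_nth b i"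
    using assms(2) by (auto simp: eventually_ball_finite_distrib tendsto_fps_iff)
  ultimately show "\<forall>\<^sub>F x in F. fps_nth (f x * g x) n = fps_nth (a * b) n"
    by eventually_elim (simp add: fps_mult_nth)
qed

lemma tendsto_add_fps:
  fixes f g :: "'b \<Rightarrow> 'a :: comm_ring_1 fps"
  assumes "(f \<longlongrightarrow> a) F" and "(g \<longlongrightarrow> b) F"
  shows "((\<lambda>x. f x + g x) \<longlongrightarrow> a + b) F"
proof (rule tendsto_fpsI)
  fix n
  have "\<forall>\<^sub>F x in F. fps_nth (f x) n = fps_nth a n" "\<forall>\<^sub>F x in F. fps_nth (g x) n = fps_nth b n"
    using assms by (auto simp: tendsto_fps_iff)
  then show "\<forall>\<^sub>F x in F. fps_nth (f x + g x) n = fps_nth (a + b) n"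
    by eventually_elim simp
qed

lemma
  defines "S \<equiv> (\<Sum>j. \<Sum>l<2^j. fps_X ^ (6 * 2^j + 2 * l) :: 'k::field fps)"
  assumes char: "CHAR('k) = 2"
  shows t_series_nth_0: "fps_nth S 0 = 0"
    and t_series_eq: "S = fps_X ^ 6 + (1 + fps_X\<^sup>2) * S\<^sup>2"
proof -
  define a :: "nat \<Rightarrow> 'k fps" where "a = (\<lambda>j. \<Sum>l<2^j. fps_X ^ (6 * 2^j + 2 * l))"
  define s where "s = (\<lambda>n. \<Sum>j<n. a j)"
  have lim: "s \<longlonglongrightarrow> S"
    using summable_LIMSEQ[OF summable_t_series] unfolding s_def a_def S_def .
  have char': "CHAR('k fps) = 2"
    using char by simp
  have a_Suc: "a (Suc j) = (1 + fps_X\<^sup>2) * (a j)\<^sup>2" for j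
    using square_geometric_sum_char_2[OF char', where x = fps_X and m = "2 ^ j" and a = "6 * 2 ^ j"]
    by (simp add: a_def mult.left_commute)
  \<comment> \<open>The partial sums satisfy the equation of \<open>S\<close> up to a shift of the
    index, which disappears in the limit.\<close>
  have rec: "s (Suc n) = fps_X ^ 6 + (1 + fps_X\<^sup>2) * (s n * s n)" for n
  proof (induction n)
    case (Suc n)
    have "s (Suc (Suc n)) = s (Suc n) + a (Suc n)"
      by (simp add: s_def)
    also have "\<dots> = fps_X ^ 6 + (1 + fps_X\<^sup>2) * ((s n)\<^sup>2 + (a n)\<^sup>2)"
      unfolding Suc.IH a_Suc by (simp add: algebra_simps power2_eq_square)
    also have "(s n)\<^sup>2 + (a n)\<^sup>2 = s (Suc n) * s (Suc n)"
      by (simp add: s_def power2_add_char_2[OF char'] flip: power2_eq_square)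
    finally show ?case .
  qed (simp add: s_def a_def)
  have "(\<lambda>n. s (Suc n)) \<longlonglongrightarrow> fps_X ^ 6 + (1 + fps_X\<^sup>2) * (S * S)"
    unfolding rec by (intro tendsto_add_fps tendsto_mult_fps tendsto_const lim)
  then show "S = fps_X ^ 6 + (1 + fps_X\<^sup>2) * S\<^sup>2"
    unfolding power2_eq_square[of S] by (rule LIMSEQ_unique[OF LIMSEQ_Suc[OF lim]])
  have "\<forall>\<^sub>F n in sequentially. fps_nth (s n) 0 = fps_nth S 0"
    using lim by (simp add: tendsto_fps_iff)
  then obtain n where "fps_nth (s n) 0 = fps_nth S 0"
    using eventually_happens' sequentially_bot by blast
  then show "fps_nth S 0 = 0"
    by (simp add: s_def a_def fps_sum_nth)
qed

lemma fps_aut_group_one: "\<one>\<^bsub>fps_aut_group\<^esub> = id"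
  by (simp add: fps_aut_group_def)

lemma fps_aut_group_pow:
  "\<sigma> [^]\<^bsub>fps_aut_group\<^esub> (n::nat) = \<sigma> ^^ n"
  by (induction n) (simp_all add: nat_pow_def fps_aut_group_def funpow_swap1 fun_eq_iff)

theorem theorem1p1:
  fixes \<sigma> :: "'k::field fps \<Rightarrow> 'k fps"
  assumes "CHAR('k) = 2"
    and "cont_alg_endo \<sigma>"
    and "\<sigma> fps_X = fps_X + fps_X ^ 2 + (\<Sum>j. \<Sum>l<2^j. fps_X ^ (6 * 2^j + 2 * l))"
  shows "\<sigma> \<in> carrier fps_aut_group \<and> group.ord fps_aut_group \<sigma> = 4"
proof -
  have char: "CHAR('k fps) = 2"
    using assms(1) by simp
  define F where "F = \<sigma> fps_X"
  define G where "G = \<sigma> F"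
  have F0: "fps_nth F 0 = 0"
    using t_series_nth_0[OF assms(1)] by (simp add: F_def assms(3))
  have \<sigma>: "\<sigma> = (\<lambda>g. g oo F)"
    using cont_alg_endo_eq_compose_iff[OF F0] assms(2) F_def by blast
  have [simp]: "\<sigma> 1 = 1" "\<sigma> 0 = 0" "\<sigma> (p + q) = \<sigma> p + \<sigma> q" "\<sigma> (p * q) = \<sigma> p * \<sigma> q"
    "\<sigma> (p ^ n) = \<sigma> p ^ n" for p q n
    using F0 by (simp_all add: \<sigma> fps_compose_add_distrib fps_compose_mult_distrib fps_compose_power)
  have \<sigma>0: "fps_nth (\<sigma> p) 0 = fps_nth p 0" for p
    by (simp add: \<sigma>)
  define S where "S = (\<Sum>j. \<Sum>l<2^j. fps_X ^ (6 * 2^j + 2 * l) :: 'k fps)"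
  \<comment> \<open>The terms \<open>fps_X^2\<close> and \<open>fps_X^4\<close> cancel in pairs; the
    remaining bracket is \<open>S + S\<close> by the equation of \<open>S\<close>.\<close>
  have "F + (1 + fps_X\<^sup>2) * F\<^sup>2 = fps_X + (S + (fps_X ^ 6 + (1 + fps_X\<^sup>2) * S\<^sup>2))"
    unfolding F_def assms(3) S_def[symmetric]
    using char by (simp add: char_2_simps flip: power_mult power_add)
  also have "\<dots> = fps_X"
    using t_series_eq[OF assms(1)] by (simp add: add_self_char_2[OF char] flip: S_def)
  finally have F: "F + (1 + fps_X\<^sup>2) * F\<^sup>2 = fps_X" .
  have "\<sigma> (F + (1 + fps_X\<^sup>2) * F\<^sup>2) = \<sigma> fps_X"
    by (simp only: F)
  then have G: "G + (1 + F\<^sup>2) * G\<^sup>2 = F"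
    by (simp add: F_def G_def)
  \<comment> \<open>Both sides are candidates for the image of \<open>y = (1 + fps_X^2) * F\<close>
    under \<open>\<sigma>\<close>: they satisfy \<open>z^2 + z = F^3 + F\<close> and have no
    constant term.\<close>
  have "G * (1 + F\<^sup>2) = F + (1 + fps_X) * F\<^sup>2"
  proof (rule artin_schreier_char_2_eq[OF char, of 1])
    have "1 * (G * (1 + F\<^sup>2))\<^sup>2 + G * (1 + F\<^sup>2) = (1 + F\<^sup>2) * (G + (1 + F\<^sup>2) * G\<^sup>2)"
      by (simp add: algebra_simps power2_eq_square)
    also have "\<dots> = F + F\<^sup>2 * F"
      unfolding G by (simp add: algebra_simps)
    \<comment> \<open>By the equation of \<open>F\<close> the new factor is
      \<open>fps_X + fps_X + F = F\<close>. Cancelling its two explicit summands \<open>F\<close>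
      instead turns \<open>F^3\<close> into
      \<open>(1 + fps_X^2) * F^4 + fps_X * F^2\<close>.\<close>
    also have "\<dots> = F + F\<^sup>2 * (F + (1 + fps_X\<^sup>2) * F\<^sup>2 + fps_X + F)"
      unfolding F using char by (simp add: char_2_simps)
    also have "\<dots> = 1 * (F + (1 + fps_X) * F\<^sup>2)\<^sup>2 + (F + (1 + fps_X) * F\<^sup>2)"
      using char by (simp add: char_2_simps power2_eq_square)
    finally show "1 * (G * (1 + F\<^sup>2))\<^sup>2 + G * (1 + F\<^sup>2)
        = 1 * (F + (1 + fps_X) * F\<^sup>2)\<^sup>2 + (F + (1 + fps_X) * F\<^sup>2)" .
    have "fps_nth (1 * (G * (1 + F\<^sup>2) + (F + (1 + fps_X) * F\<^sup>2))) 0 = 0"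
      using F0 by (simp add: G_def \<sigma>0)
    then show "1 * (G * (1 + F\<^sup>2) + (F + (1 + fps_X) * F\<^sup>2)) \<noteq> 1"
      by (metis fps_one_nth zero_neq_one)
  qed
  moreover have "fps_nth (1 + F\<^sup>2) 0 \<noteq> 0"
    using F0 by (simp add: fps_power_zeroth)
  then have "1 + F\<^sup>2 \<noteq> 0"
    by (metis fps_zero_nth)
  ultimately have XG: "fps_X + G + fps_X\<^sup>2 + G\<^sup>2 + fps_X\<^sup>2 * G\<^sup>2 = 0"
    using curve_map_relation[OF char F] by blast
  define L where "L = \<sigma> (\<sigma> G)"
  have "\<sigma> (\<sigma> (fps_X + G + fps_X\<^sup>2 + G\<^sup>2 + fps_X\<^sup>2 * G\<^sup>2)) = 0"
    by (simp only: XG \<open>\<sigma> 0 = 0\<close>)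
  then have GL: "G + L + G\<^sup>2 + L\<^sup>2 + G\<^sup>2 * L\<^sup>2 = 0"
    by (simp add: G_def F_def L_def)
  have "L = fps_X"
  proof (rule artin_schreier_char_2_eq[OF char, of "1 + G\<^sup>2"])
    show "(1 + G\<^sup>2) * L\<^sup>2 + L = (1 + G\<^sup>2) * fps_X\<^sup>2 + fps_X"
      \<comment> \<open>Both sides equal \<open>- (G + G^2)\<close>, by the two relations.\<close>
      using XG GL by Groebner_Basis.algebra
    have "fps_nth ((1 + G\<^sup>2) * (L + fps_X)) 0 = 0"
      using F0 by (simp add: L_def G_def \<sigma>0)
    then show "(1 + G\<^sup>2) * (L + fps_X) \<noteq> 1"
      by (metis fps_one_nth zero_neq_one)
  qed
  then have "(\<sigma> ^^ 4) fps_X = fps_X"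
    by (simp add: L_def G_def F_def numeral_eq_Suc)
  moreover have endo: "cont_alg_endo (\<sigma> ^^ n)" for n
    using assms(2) by (induction n) (auto intro: cont_alg_endo_comp cont_alg_endo_id)
  \<comment> \<open>A continuous endomorphism is determined by its value at \<open>fps_X\<close>,
    and substituting \<open>fps_X\<close> is the identity.\<close>
  ultimately have \<sigma>4: "\<sigma> ^^ 4 = id"
    using cont_alg_endo_eq_compose_iff[of fps_X "\<sigma> ^^ 4"] by (simp add: fun_eq_iff)
  then have "\<sigma> \<circ> \<sigma> ^^ 3 = id" "\<sigma> ^^ 3 \<circ> \<sigma> = id"
    by (simp_all add: numeral_eq_Suc o_assoc)
  then have carrier: "\<sigma> \<in> carrier fps_aut_group"
    using assms(2) endo by (auto simp: fps_aut_group_def)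
  interpret group "fps_aut_group :: ('k fps \<Rightarrow> 'k fps) monoid"
    by (rule group_fps_aut_group)
  have "\<sigma> ^^ 2 \<noteq> id"
  proof
    assume "\<sigma> ^^ 2 = id"
    then have "G = fps_X"
      by (simp add: G_def F_def numeral_eq_Suc fun_eq_iff)
    then have "fps_X ^ 4 = (0 :: 'k fps)"
      using XG char by (simp add: char_2_simps flip: power_add)
    then show False
      by simp
  qed
  then have dvd: "ord \<sigma> dvd 4" "\<not> ord \<sigma> dvd 2"
    using pow_eq_id[OF carrier] \<sigma>4 by (simp_all add: fps_aut_group_pow fps_aut_group_one)
  then obtain i where "i \<le> 2" "ord \<sigma> = 2 ^ i"
    using divides_primepow_nat[OF two_is_prime_nat, of "ord \<sigma>" 2] by auto
  with dvd have "ord \<sigma> = 4"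
    by (auto simp: numeral_2_eq_2 le_Suc_eq)
  then show ?thesis
    using carrier by simp
qed

end
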